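(* Let $\mathbf{D}$ be a double Boolean algebra and consider $\mathbb{K}^T(\mathbf{D})=((\mathcal{F}_{pr}(\mathbf{D}),\mathcal{T}),(\mathcal{I}_{pr}(\mathbf{D}),\mathcal{J}),\Delta)$. Let $A\subseteq\mathcal{F}_{pr}(\mathbf{D})$ and $B\subseteq\mathcal{I}_{pr}(\mathbf{D})$. Then: (1) If $\mathbf{D}$ is fully contextual, then $(A,B)$ is a clopen protoconcept if and only if $A=F_x$ and $B=I_x$ for some $x\in D$. (2) If $\mathbf{D}$ is pure, then $(A,B)$ is a clopen semiconcept if and only if $A=F_x$ and $B=I_x$ for some $x\in D$.
   Context: For an algebra $(D;\sqcap,\sqcup,\neg,\lrcorner,\top,\bot)$ of type $(2,2,1,1,0,0)$ write $x\vee y:=\neg(\neg x\sqcap\neg y)$, $x\wedge y:=\lrcorner(\lrcorner x\sqcup\lrcorner y)$. A double Boolean algebra (dBa) is such an algebra satisfying, for all $x,y,z$: $(x\sqcap x)\sqcap y=x\sqcap y$; $(x\sqcup x)\sqcup y=x\sqcup y$; $x\sqcap y=y\sqcap x$; $x\sqcup y=y\sqcup x$; $\neg(x\sqcap x)=\neg x$; $\lrcorner(x\sqcup x)=\lrcorner x$; $x\sqcap(x\sqcup y)=x\sqcap x$; $x\sqcup(x\sqcap y)=x\sqcup x$; $x\sqcap(y\vee z)=(x\sqcap y)\vee(x\sqcap z)$; $x\sqcup(y\wedge z)=(x\sqcup y)\wedge(x\sqcup z)$; $x\sqcap(x\vee y)=x\sqcap x$; $x\sqcup(x\wedge y)=x\sqcup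 x$; $\neg\neg(x\sqcap y)=x\sqcap y$; $\lrcorner\lrcorner(x\sqcup y)=x\sqcup y$; $x\sqcap\neg x=\bot$; $x\sqcup\lrcorner x=\top$; $\neg\top=\bot$; $\lrcorner\bot=\top$; $x\sqcap(y\sqcap z)=(x\sqcap y)\sqcap z$; $x\sqcup(y\sqcup z)=(x\sqcup y)\sqcup z$; $\neg\bot=\top\sqcap\top$; $\lrcorner\top=\bot\sqcup\bot$; $(x\sqcap x)\sqcup(x\sqcap x)=(x\sqcup x)\sqcap(x\sqcup x)$. Put $x\sqsubseteq y$ iff $x\sqcap y=x\sqcap x$ and $x\sqcup y=y\sqcup y$; $D_\sqcap=\{x\mid x\sqcap x=x\}$, $D_\sqcup=\{x\mid x\sqcup x=x\}$. The dBa is contextual if $\sqsubseteq$ is a partial order; fully contextual if contextual and for all $y\in D_\sqcap$, $x\in D_\sqcup$ with $y\sqcup y=x\sqcap x$ there is a unique $z\in D$ with $z\sqcap z=y$ and $z\sqcup z=x$; pure if every $x$ has $x\sqcap x=x$ or $x\sqcup x=x$. Filters/ideals: a filter is $F\subseteq D$ closed under $\sqcap$ and upward closed w.r.t. $\sqsubseteq$; an ideal is $I\subseteq D$ closed under $\sqcup$ and downward closed w.r.t. $\sqsubseteq$. A primary filter is a nonempty filter $F\ne D$ with $x\in F$ or $\neg x\in F$ for all $x$; a primary ideal is a nonempty ideal $I\neq D$ with $x\in I$ or $\lrcorner x\in I$ for all $x$. $\mathcal{F}_{pr}(\mathbf{D})$, $\mathcal{I}_{pr}(\mathbf{D})$ are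 the sets of these; $F_x=\{F\in\mathcal{F}_{pr}(\mathbf{D})\mid x\in F\}$, $I_x=\{I\in\mathcal{I}_{pr}(\mathbf{D})\mid x\in I\}$. $\mathcal{T}$ (resp. $\mathcal{J}$) is the topology with $\{F_x\mid x\in D\}$ (resp. $\{I_x\mid x\in D\}$) as subbase for the closed sets. $F\,\Delta\, I$ iff $F\cap I\neq\emptyset$. For a formal context $(G,M,R)$ and $A\subseteq G$, $B\subseteq M$: $A'=\{m\in M\mid gRm\ \forall g\in A\}$, $B'=\{g\in G\mid gRm\ \forall m\in B\}$. $(A,B)$ is a protoconcept if $A''=B'$, and a semiconcept if $A'=B$ or $B'=A$. Given topologies on $G$ and $M$, a clopen protoconcept (resp. clopen semiconcept) is a protoconcept (resp. semiconcept) $(A,B)$ with $A$ clopen in $G$ and $B$ clopen in $M$. *)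

theory Defs
  imports "HOL-Analysis.Abstract_Topology"
begin

section \<open>Double Boolean algebras\<close>

text \<open>
  The universe of the algebra is the whole type \<open>'a\<close>. The two negations are written
  \<open>\<^bold>\<not>\<close> (for the usual negation sign, belonging to the meet) and \<open>\<^bold>\<sim>\<close> (for the opposition sign
  \<open>lrcorner\<close>, belonging to the join).
\<close>

record 'a dba_ops =
  dmeet :: "'a \<Rightarrow> 'a \<Rightarrow> 'a" (infixl \<open>\<sqinter>\<index>\<close> 70)
  djoin :: "'a \<Rightarrow> 'a \<Rightarrow> 'a" (infixl \<open>\<squnion>\<index>\<close> 65)
  dneg :: "'a \<Rightarrow> 'a" (\<open>\<^bold>\<not>\<index> _\<close> [81] 80)
  dopp :: "'a \<Rightarrow> 'a" (\<open>\<^bold>\<sim>\<index> _\<close> [81] 80)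
  dtop :: "'a" (\<open>\<top>\<index>\<close>)
  dbot :: "'a" (\<open>\<bottom>\<index>\<close>)

definition dvee :: "'a dba_ops \<Rightarrow> 'a \<Rightarrow> 'a \<Rightarrow> 'a" (infixl \<open>\<curlyvee>\<index>\<close> 65)
  where "x \<curlyvee>\<^bsub>D\<^esub> y = \<^bold>\<not>\<^bsub>D\<^esub> (\<^bold>\<not>\<^bsub>D\<^esub> x \<sqinter>\<^bsub>D\<^esub> \<^bold>\<not>\<^bsub>D\<^esub> y)"

definition dwedge :: "'a dba_ops \<Rightarrow> 'a \<Rightarrow> 'a \<Rightarrow> 'a" (infixl \<open>\<curlywedge>\<index>\<close> 70)
  where "x \<curlywedge>\<^bsub>D\<^esub> y = \<^bold>\<sim>\<^bsub>D\<^esub> (\<^bold>\<sim>\<^bsub>D\<^esub> x \<squnion>\<^bsub>D\<^esub> \<^bold>\<sim>\<^bsub>D\<^esub> y)"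

locale double_Boolean_algebra =
  fixes D :: "'a dba_ops" (structure)
  assumes meet_idem_left: "(x \<sqinter> x) \<sqinter> y = x \<sqinter> y"
    and join_idem_left: "(x \<squnion> x) \<squnion> y = x \<squnion> y"
    and meet_commute: "x \<sqinter> y = y \<sqinter> x"
    and join_commute: "x \<squnion> y = y \<squnion> x"
    and neg_meet_idem: "\<^bold>\<not> (x \<sqinter> x) = \<^bold>\<not> x"
    and opp_join_idem: "\<^bold>\<sim> (x \<squnion> x) = \<^bold>\<sim> x"
    and meet_join_absorb: "x \<sqinter> (x \<squnion> y) = x \<sqinter> x"
    and join_meet_absorb: "x \<squnion> (x \<sqinter> y) = x \<squnion> x"
    and meet_vee_distrib: "x \<sqinter> (y \<curlyvee> z) = (x \<sqinter> y) \<curlyvee> (x \<sqinter> z)"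
    and join_wedge_distrib: "x \<squnion> (y \<curlywedge> z) = (x \<squnion> y) \<curlywedge> (x \<squnion> z)"
    and meet_vee_absorb: "x \<sqinter> (x \<curlyvee> y) = x \<sqinter> x"
    and join_wedge_absorb: "x \<squnion> (x \<curlywedge> y) = x \<squnion> x"
    and neg_neg_meet: "\<^bold>\<not> (\<^bold>\<not> (x \<sqinter> y)) = x \<sqinter> y"
    and opp_opp_join: "\<^bold>\<sim> (\<^bold>\<sim> (x \<squnion> y)) = x \<squnion> y"
    and meet_neg: "x \<sqinter> \<^bold>\<not> x = \<bottom>"
    and join_opp: "x \<squnion> \<^bold>\<sim> x = \<top>"
    and neg_top: "\<^bold>\<not> \<top> = \<bottom>"
    and opp_bot: "\<^bold>\<sim> \<bottom> = \<top>"
    and meet_assoc: "x \<sqinter> (y \<sqinter> z) = (x \<sqinter> y) \<sqinter> z"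
    and join_assoc: "x \<squnion> (y \<squnion> z) = (x \<squnion> y) \<squnion> z"
    and neg_bot: "\<^bold>\<not> \<bottom> = \<top> \<sqinter> \<top>"
    and opp_top: "\<^bold>\<sim> \<top> = \<bottom> \<squnion> \<bottom>"
    and meet_join_idem: "(x \<sqinter> x) \<squnion> (x \<sqinter> x) = (x \<squnion> x) \<sqinter> (x \<squnion> x)"

definition dle :: "'a dba_ops \<Rightarrow> 'a \<Rightarrow> 'a \<Rightarrow> bool" (infix \<open>\<sqsubseteq>\<index>\<close> 50)
  where "x \<sqsubseteq>\<^bsub>D\<^esub> y \<longleftrightarrow> x \<sqinter>\<^bsub>D\<^esub> y = x \<sqinter>\<^bsub>D\<^esub> x \<and> x \<squnion>\<^bsub>D\<^esub> y = y \<squnion>\<^bsub>D\<^esub> y"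

definition meet_idempotents :: "'a dba_ops \<Rightarrow> 'a set"
  where "meet_idempotents D = {x. x \<sqinter>\<^bsub>D\<^esub> x = x}"

definition join_idempotents :: "'a dba_ops \<Rightarrow> 'a set"
  where "join_idempotents D = {x. x \<squnion>\<^bsub>D\<^esub> x = x}"

definition contextual :: "'a dba_ops \<Rightarrow> bool"
  where "contextual D \<longleftrightarrow> partial_order_on UNIV {(x, y). x \<sqsubseteq>\<^bsub>D\<^esub> y}"

definition fully_contextual :: "'a dba_ops \<Rightarrow> bool"
  where "fully_contextual D \<longleftrightarrow> contextual D \<and>
    (\<forall>y \<in> meet_idempotents D. \<forall>x \<in> join_idempotents D. y \<squnion>\<^bsub>D\<^esub> y = x \<sqinter>\<^bsub>D\<^esub> x \<longrightarrow>
      (\<exists>!z. z \<sqinter>\<^bsub>D\<^esub> z = y \<and> z \<squnion>\<^bsub>D\<^esub> z = x))"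

definition pure_dba :: "'a dba_ops \<Rightarrow> bool"
  where "pure_dba D \<longleftrightarrow> (\<forall>x. x \<sqinter>\<^bsub>D\<^esub> x = x \<or> x \<squnion>\<^bsub>D\<^esub> x = x)"

section \<open>Primary filters and ideals\<close>

definition dba_filter :: "'a dba_ops \<Rightarrow> 'a set \<Rightarrow> bool"
  where "dba_filter D F \<longleftrightarrow>
    (\<forall>x \<in> F. \<forall>y \<in> F. x \<sqinter>\<^bsub>D\<^esub> y \<in> F) \<and> (\<forall>x \<in> F. \<forall>y. x \<sqsubseteq>\<^bsub>D\<^esub> y \<longrightarrow> y \<in> F)"

definition dba_ideal :: "'a dba_ops \<Rightarrow> 'a set \<Rightarrow> bool"
  where "dba_ideal D I \<longleftrightarrow>
    (\<forall>x \<in> I. \<forall>y \<in> I. x \<squnion>\<^bsub>D\<^esub> y \<in> I) \<and> (\<forall>x \<in> I. \<forall>y. y \<sqsubseteq>\<^bsub>D\<^esub> x \<longrightarrow> y \<in> I)"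

definition primary_filters :: "'a dba_ops \<Rightarrow> 'a set set"
  where "primary_filters D =
    {F. dba_filter D F \<and> F \<noteq> {} \<and> F \<noteq> UNIV \<and> (\<forall>x. x \<in> F \<or> \<^bold>\<not>\<^bsub>D\<^esub> x \<in> F)}"

definition primary_ideals :: "'a dba_ops \<Rightarrow> 'a set set"
  where "primary_ideals D =
    {I. dba_ideal D I \<and> I \<noteq> {} \<and> I \<noteq> UNIV \<and> (\<forall>x. x \<in> I \<or> \<^bold>\<sim>\<^bsub>D\<^esub> x \<in> I)}"

definition filters_at :: "'a dba_ops \<Rightarrow> 'a \<Rightarrow> 'a set set"
  where "filters_at D x = {F \<in> primary_filters D. x \<in> F}"

definition ideals_at :: "'a dba_ops \<Rightarrow> 'a \<Rightarrow> 'a set set"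
  where "ideals_at D x = {I \<in> primary_ideals D. x \<in> I}"

section \<open>Topologies given by a subbase for the closed sets\<close>

text \<open>
  Inserting \<open>X\<close> accounts for the empty intersection of subbasic open sets, so that the underlying
  space is always \<open>X\<close>.
\<close>

definition topology_of_closed_subbase :: "'b set \<Rightarrow> 'b set set \<Rightarrow> 'b topology"
  where "topology_of_closed_subbase X \<C> = topology_generated_by (insert X ((\<lambda>C. X - C) ` \<C>))"

lemma topspace_topology_of_closed_subbase [simp]:
  "topspace (topology_of_closed_subbase X \<C>) = X"
  by (auto simp: topology_of_closed_subbase_def)

definition filter_topology :: "'a dba_ops \<Rightarrow> 'a set topology"
  where "filter_topology D = topology_of_closed_subbase (primary_filters D) (range (filters_at D))"

definition ideal_topology :: "'a dba_ops \<Rightarrow> 'a set topology"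
  where "ideal_topology D = topology_of_closed_subbase (primary_ideals D) (range (ideals_at D))"

lemma topspace_filter_topology [simp]: "topspace (filter_topology D) = primary_filters D"
  by (simp add: filter_topology_def)

lemma topspace_ideal_topology [simp]: "topspace (ideal_topology D) = primary_ideals D"
  by (simp add: ideal_topology_def)

section \<open>Formal contexts\<close>

definition common_attributes :: "'m set \<Rightarrow> ('g \<Rightarrow> 'm \<Rightarrow> bool) \<Rightarrow> 'g set \<Rightarrow> 'm set"
  where "common_attributes M R A = {m \<in> M. \<forall>g \<in> A. R g m}"

definition common_objects :: "'g set \<Rightarrow> ('g \<Rightarrow> 'm \<Rightarrow> bool) \<Rightarrow> 'm set \<Rightarrow> 'g set"
  where "common_objects G R B = {g \<in> G. \<forall>m \<in> B. R g m}"

definition protoconcept ::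
    "'g set \<Rightarrow> 'm set \<Rightarrow> ('g \<Rightarrow> 'm \<Rightarrow> bool) \<Rightarrow> 'g set \<times> 'm set \<Rightarrow> bool"
  where "protoconcept G M R = (\<lambda>(A, B). A \<subseteq> G \<and> B \<subseteq> M \<and>
    common_objects G R (common_attributes M R A) = common_objects G R B)"

definition semiconcept ::
    "'g set \<Rightarrow> 'm set \<Rightarrow> ('g \<Rightarrow> 'm \<Rightarrow> bool) \<Rightarrow> 'g set \<times> 'm set \<Rightarrow> bool"
  where "semiconcept G M R = (\<lambda>(A, B). A \<subseteq> G \<and> B \<subseteq> M \<and>
    (common_attributes M R A = B \<or> common_objects G R B = A))"

text \<open>A context with topologies is a triple \<open>(S, T, R)\<close>; its objects and attributes are the points of
  the spaces \<open>S\<close> and \<open>T\<close>.\<close>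

type_synonym ('g, 'm) top_context = "'g topology \<times> 'm topology \<times> ('g \<Rightarrow> 'm \<Rightarrow> bool)"

definition clopen_in :: "'b topology \<Rightarrow> 'b set \<Rightarrow> bool"
  where "clopen_in T A \<longleftrightarrow> openin T A \<and> closedin T A"

definition clopen_protoconcept :: "('g, 'm) top_context \<Rightarrow> 'g set \<times> 'm set \<Rightarrow> bool"
  where "clopen_protoconcept = (\<lambda>(S, T, R) (A, B).
    protoconcept (topspace S) (topspace T) R (A, B) \<and> clopen_in S A \<and> clopen_in T B)"

definition clopen_semiconcept :: "('g, 'm) top_context \<Rightarrow> 'g set \<times> 'm set \<Rightarrow> bool"
  where "clopen_semiconcept = (\<lambda>(S, T, R) (A, B).
    semiconcept (topspace S) (topspace T) R (A, B) \<and> clopen_in S A \<and> clopen_in T B)"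

definition dba_context :: "'a dba_ops \<Rightarrow> ('a set, 'a set) top_context"
  where "dba_context D = (filter_topology D, ideal_topology D, \<lambda>F I. F \<inter> I \<noteq> {})"

end

theory Submission
  imports Defs
begin

text \<open>
  Primary filters correspond to ultrafilters of the Boolean algebra of meet idempotents. A prime ideal
  theorem (via Zorn's lemma) gives three things: \<open>F\<^sub>x\<close> determines \<open>x \<sqinter> x\<close>, every clopen set of
  primary filters is some \<open>F\<^sub>x\<close>, and the derivation operator sends \<open>F\<^sub>x\<close> to the ideals containing
  \<open>x \<sqinter> x\<close>. Everything dualizes by exchanging meet and join. For a clopen protoconcept
  \<open>(F\<^sub>y, I\<^sub>x)\<close> the condition \<open>A'' = B'\<close> therefore becomes \<open>y \<squnion> y = x \<sqinter> x\<close> (with \<open>y\<close>, \<open>x\<close>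
  idempotent), which is what full contextuality needs to produce the representing element.
\<close>

section \<open>Exchange of meet and join\<close>

definition dual_dba :: "'a dba_ops \<Rightarrow> 'a dba_ops"
  where "dual_dba D = \<lparr>dmeet = djoin D, djoin = dmeet D, dneg = dopp D, dopp = dneg D,
    dtop = dbot D, dbot = dtop D\<rparr>"

lemma dual_dba_sel [simp]:
  "dmeet (dual_dba D) = djoin D" "djoin (dual_dba D) = dmeet D"
  "dneg (dual_dba D) = dopp D" "dopp (dual_dba D) = dneg D"
  "dtop (dual_dba D) = dbot D" "dbot (dual_dba D) = dtop D"
  "dvee (dual_dba D) = dwedge D" "dwedge (dual_dba D) = dvee D"
  by (simp_all add: dual_dba_def dvee_def dwedge_def fun_eq_iff)

context double_Boolean_algebra
begin

text \<open>The axioms come in pairs that the exchange swaps; only \<open>meet_join_idem\<close>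
  stands alone, and it turns into itself read backwards.\<close>

lemma double_Boolean_algebra_dual: "double_Boolean_algebra (dual_dba D)"
  by (unfold_locales; unfold dual_dba_sel;
      rule meet_idem_left join_idem_left neg_meet_idem opp_join_idem
        meet_join_absorb join_meet_absorb meet_vee_distrib join_wedge_distrib meet_vee_absorb
        join_wedge_absorb neg_neg_meet opp_opp_join meet_neg join_opp neg_top opp_bot
        meet_assoc join_assoc neg_bot opp_top meet_join_idem [symmetric] meet_commute join_commute)

lemma dle_dual: "x \<sqsubseteq>\<^bsub>dual_dba D\<^esub> y \<longleftrightarrow> y \<sqsubseteq> x"
  by (auto simp: dle_def meet_commute join_commute)

lemma dba_filter_dual: "dba_filter (dual_dba D) F \<longleftrightarrow> dba_ideal D F"
  by (simp add: dba_filter_def dba_ideal_def dle_dual)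

lemma primary_filters_dual: "primary_filters (dual_dba D) = primary_ideals D"
  by (simp add: primary_filters_def primary_ideals_def dba_filter_dual)

lemma primary_ideals_dual: "primary_ideals (dual_dba D) = primary_filters D"
  by (simp add: primary_filters_def primary_ideals_def dba_filter_def dba_ideal_def dle_dual)

lemma filters_at_dual: "filters_at (dual_dba D) = ideals_at D"
  by (simp add: filters_at_def ideals_at_def primary_filters_dual fun_eq_iff)

lemma ideals_at_dual: "ideals_at (dual_dba D) = filters_at D"
  by (simp add: filters_at_def ideals_at_def primary_ideals_dual fun_eq_iff)

lemma filter_topology_dual: "filter_topology (dual_dba D) = ideal_topology D"
  by (simp add: filter_topology_def ideal_topology_def filters_at_dual primary_filters_dual)

section \<open>Calculus of meets and squares\<close>

lemma meet_left_commute: "x \<sqinter> (y \<sqinter> z) = y \<sqinter> (x \<sqinter> z)"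
  by (metis meet_assoc meet_commute)

lemmas meet_ac = meet_assoc [symmetric] meet_commute meet_left_commute

lemma meet_left_idem: "x \<sqinter> (x \<sqinter> y) = x \<sqinter> y"
  by (metis meet_assoc meet_idem_left)

lemma meet_right_idem: "x \<sqinter> (y \<sqinter> y) = x \<sqinter> y"
  by (metis meet_commute meet_idem_left)

text \<open>The meet half of \<sqsubseteq> serves below as a preorder of its own: it compares the
  squares of x and y among the meet idempotents.\<close>

lemma meet_eq_trans:
  assumes "x \<sqinter> y = x \<sqinter> x" "y \<sqinter> z = y \<sqinter> y"
  shows "x \<sqinter> z = x \<sqinter> x"
proof -
  have "x \<sqinter> z = (x \<sqinter> y) \<sqinter> z"
    unfolding assms(1) by (rule meet_idem_left [symmetric])
  also have "\<dots> = x \<sqinter> (y \<sqinter> y)"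
    by (simp only: meet_assoc [symmetric] assms(2))
  also have "\<dots> = x \<sqinter> x"
    by (simp only: meet_right_idem assms(1))
  finally show ?thesis .
qed

lemma meet_dle_left: "x \<sqinter> y \<sqsubseteq> x"
  by (simp add: dle_def meet_ac meet_left_idem meet_right_idem)
    (metis join_commute join_meet_absorb)

lemma meet_dle_right: "x \<sqinter> y \<sqsubseteq> y"
  by (metis meet_commute meet_dle_left)

lemma neg_idem: "\<^bold>\<not> x \<sqinter> \<^bold>\<not> x = \<^bold>\<not> x"
  by (metis neg_meet_idem neg_neg_meet)

lemma vee_idem: "(x \<curlyvee> y) \<sqinter> (x \<curlyvee> y) = x \<curlyvee> y"
  by (simp add: dvee_def neg_idem)

lemma vee_meet_idem: "(x \<sqinter> x) \<curlyvee> (y \<sqinter> y) = x \<curlyvee> y"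
  by (simp add: dvee_def neg_meet_idem)

text \<open>Excluded middle: y \<curlyvee> \<not>y equals \<top> \<sqinter> \<top>, which is a unit
  for the meet only up to squaring.\<close>

lemma meet_vee_neg: "x \<sqinter> (y \<curlyvee> \<^bold>\<not> y) = x \<sqinter> x"
proof -
  have "x \<sqinter> (y \<curlyvee> \<^bold>\<not> y) = x \<sqinter> \<top>"
    by (simp add: dvee_def meet_neg neg_bot meet_right_idem)
  also have "\<dots> = x \<sqinter> x"
    by (metis join_opp meet_join_absorb)
  finally show ?thesis .
qed

lemma bot_dle: "\<bottom> \<sqsubseteq> x"
  using meet_dle_left[of x "\<^bold>\<not> x"] by (simp add: meet_neg)

section \<open>Primary filters and the Boolean operations\<close>

lemma primary_filterD:
  assumes "F \<in> primary_filters D"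
  shows "\<lbrakk>x \<in> F; y \<in> F\<rbrakk> \<Longrightarrow> x \<sqinter> y \<in> F" and "\<lbrakk>x \<in> F; x \<sqsubseteq> y\<rbrakk> \<Longrightarrow> y \<in> F"
    and "x \<in> F \<or> \<^bold>\<not> x \<in> F" and "F \<noteq> UNIV"
  using assms by (auto simp: primary_filters_def dba_filter_def)

lemma mem_primary_filter_meet_iff:
  "F \<in> primary_filters D \<Longrightarrow> x \<sqinter> y \<in> F \<longleftrightarrow> x \<in> F \<and> y \<in> F"
  using primary_filterD meet_dle_left meet_dle_right by metis

lemma mem_primary_filter_neg_iff:
  assumes "F \<in> primary_filters D"
  shows "\<^bold>\<not> x \<in> F \<longleftrightarrow> x \<notin> F"
proof -
  have "\<bottom> \<notin> F"
    using primary_filterD(2,4)[OF assms] bot_dle by blast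
  then show ?thesis
    using mem_primary_filter_meet_iff[OF assms, of x "\<^bold>\<not> x"] primary_filterD(3)[OF assms, of x]
    by (auto simp: meet_neg)
qed

lemma mem_primary_filter_vee_iff:
  "F \<in> primary_filters D \<Longrightarrow> x \<curlyvee> y \<in> F \<longleftrightarrow> x \<in> F \<or> y \<in> F"
  by (simp add: dvee_def mem_primary_filter_neg_iff mem_primary_filter_meet_iff)

lemma filters_at_meet: "filters_at D (x \<sqinter> y) = filters_at D x \<inter> filters_at D y"
  by (auto simp: filters_at_def mem_primary_filter_meet_iff)

lemma filters_at_neg: "filters_at D (\<^bold>\<not> x) = primary_filters D - filters_at D x"
  by (auto simp: filters_at_def mem_primary_filter_neg_iff)

lemma filters_at_vee: "filters_at D (x \<curlyvee> y) = filters_at D x \<union> filters_at D y"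
  by (auto simp: filters_at_def mem_primary_filter_vee_iff)

lemma filters_at_mono: "x \<sqsubseteq> y \<Longrightarrow> filters_at D x \<subseteq> filters_at D y"
  by (auto simp: filters_at_def dest: primary_filterD(2))

section \<open>Prime ideal theorem\<close>

text \<open>G is the filter generated by F and x. Its equation encodes f \<sqinter> x \<sqsubseteq>
  z: the join half follows from \<open>meet_dle_right\<close>.\<close>

lemma dba_filter_adjoin:
  fixes x :: 'a
  assumes "dba_filter D F" "F \<noteq> {}"
  defines "G \<equiv> {z. \<exists>f\<in>F. f \<sqinter> x \<sqinter> z = f \<sqinter> x}"
  shows "dba_filter D G" "F \<subseteq> G" "x \<in> G"
proof -
  have cl: "\<And>a b. a \<in> F \<Longrightarrow> b \<in> F \<Longrightarrow> a \<sqinter> b \<in> F"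
    using assms by (auto simp: dba_filter_def)
  have "a \<sqinter> b \<in> G" if "a \<in> G" "b \<in> G" for a b
  proof -
    from that obtain f g where fg: "f \<in> F" "g \<in> F" "f \<sqinter> x \<sqinter> a = f \<sqinter> x" "g \<sqinter> x \<sqinter> b = g \<sqinter> x"
      by (auto simp: G_def)
    have "(f \<sqinter> g) \<sqinter> x \<sqinter> (a \<sqinter> b) = (f \<sqinter> x \<sqinter> a) \<sqinter> (g \<sqinter> x \<sqinter> b)"
      by (simp add: meet_ac meet_left_idem meet_right_idem)
    also have "\<dots> = (f \<sqinter> g) \<sqinter> x"
      unfolding fg by (simp add: meet_ac meet_left_idem meet_right_idem)
    finally show ?thesis
      using cl[OF fg(1,2)] by (auto simp: G_def)
  qed
  moreover have "b \<in> G" if "a \<in> G" "a \<sqsubseteq> b" for a b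
  proof -
    from that obtain f where f: "f \<in> F" "f \<sqinter> x \<sqinter> a = f \<sqinter> x"
      by (auto simp: G_def)
    have "f \<sqinter> x \<sqinter> b = f \<sqinter> x \<sqinter> (a \<sqinter> b)"
      by (simp add: meet_assoc f)
    also have "\<dots> = f \<sqinter> x"
      using that(2) f by (simp add: dle_def meet_right_idem)
    finally show ?thesis
      using f by (auto simp: G_def)
  qed
  ultimately show "dba_filter D G"
    by (auto simp: dba_filter_def)
  show "F \<subseteq> G"
  proof
    fix y assume "y \<in> F"
    moreover have "y \<sqinter> x \<sqinter> y = y \<sqinter> x"
      by (simp add: meet_ac meet_left_idem meet_right_idem)
    ultimately show "y \<in> G"
      by (auto simp: G_def)
  qed
  show "x \<in> G"
    using \<open>F \<noteq> {}\<close> by (auto simp: G_def meet_ac meet_right_idem)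
qed

text \<open>If F missed both y and its negation, adjoining either would run into N. Distributivity
  then puts (f \<sqinter> g) \<sqinter> (y \<curlyvee> \<not>y) into N, but by
  \<open>meet_vee_neg\<close> this is the square of f \<sqinter> g, an element of F.\<close>

lemma maximal_disjoint_filter_primary:
  assumes N_vee: "\<And>y z. \<lbrakk>y \<in> N; z \<in> N\<rbrakk> \<Longrightarrow> y \<curlyvee> z \<in> N"
    and N_down: "\<And>y z. \<lbrakk>y \<in> N; z \<sqsubseteq> y\<rbrakk> \<Longrightarrow> z \<in> N" and "N \<noteq> {}"
    and F: "dba_filter D F" "F \<noteq> {}" "F \<inter> N = {}"
    and max: "\<And>G. \<lbrakk>dba_filter D G; F \<subseteq> G; G \<inter> N = {}\<rbrakk> \<Longrightarrow> G = F"
  shows "F \<in> primary_filters D"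
proof -
  have witness: "\<exists>f\<in>F. f \<sqinter> y \<in> N" if "y \<notin> F" for y
  proof -
    let ?G = "{z. \<exists>f\<in>F. f \<sqinter> y \<sqinter> z = f \<sqinter> y}"
    \<comment> \<open>Otherwise maximality would give \<open>?G = F\<close>, although y lies in
      \<open>?G\<close> and not in F.\<close>
    have "?G \<inter> N \<noteq> {}"
      using max dba_filter_adjoin[OF F(1,2), of y] that by blast
    then obtain f z where "f \<in> F" "f \<sqinter> y \<sqinter> z = f \<sqinter> y" "z \<in> N"
      by auto
    then show ?thesis
      by (metis N_down meet_dle_right)
  qed
  have "y \<in> F \<or> \<^bold>\<not> y \<in> F" for y
  proof (rule ccontr)
    assume "\<not> (y \<in> F \<or> \<^bold>\<not> y \<in> F)"
    then obtain f g where fg: "f \<in> F" "g \<in> F" "f \<sqinter> y \<in> N" "g \<sqinter> \<^bold>\<not> y \<in> N"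
      using witness by meson
    have "(f \<sqinter> g) \<sqinter> y \<in> N"
      by (rule N_down[OF fg(3)]) (metis meet_dle_right meet_assoc meet_commute)
    moreover have "(f \<sqinter> g) \<sqinter> \<^bold>\<not> y \<in> N"
      by (rule N_down[OF fg(4)]) (metis meet_dle_right meet_assoc)
    ultimately have "(f \<sqinter> g) \<sqinter> (y \<curlyvee> \<^bold>\<not> y) \<in> N"
      by (simp add: meet_vee_distrib N_vee)
    moreover have "(f \<sqinter> g) \<sqinter> (f \<sqinter> g) \<in> F"
      using F(1) fg(1,2) by (auto simp: dba_filter_def)
    ultimately show False
      using F(3) by (auto simp: meet_vee_neg)
  qed
  then show ?thesis
    using F \<open>N \<noteq> {}\<close> by (auto simp: primary_filters_def)
qed

text \<open>A primary ideal is downward closed and closed under \<open>\<curlyvee>\<close>, but need not contain \<open>x\<close> when it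
  contains \<open>x \<sqinter> x\<close>; hence the square in the hypothesis.\<close>

lemma primary_filter_exists:
  assumes N_vee: "\<And>y z. \<lbrakk>y \<in> N; z \<in> N\<rbrakk> \<Longrightarrow> y \<curlyvee> z \<in> N"
    and N_down: "\<And>y z. \<lbrakk>y \<in> N; z \<sqsubseteq> y\<rbrakk> \<Longrightarrow> z \<in> N" and "N \<noteq> {}"
    and x: "x \<sqinter> x \<notin> N"
  shows "\<exists>F\<in>primary_filters D. x \<in> F \<and> F \<inter> N = {}"
proof -
  let ?A = "{F. dba_filter D F \<and> x \<in> F \<and> F \<inter> N = {}}"
  \<comment> \<open>The filter generated by x, the starting point for Zorn's lemma. It avoids N
    because x \<sqinter> x = x \<sqinter> z lies below each of its members z.\<close>
  let ?P = "{z. x \<sqinter> z = x \<sqinter> x}"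
  have "z \<notin> N" if "x \<sqinter> z = x \<sqinter> x" for z
    using x N_down[of z "x \<sqinter> x"] that meet_dle_right[of x z] by metis
  moreover have "dba_filter D ?P"
    unfolding dba_filter_def mem_Collect_eq Ball_def
    by (auto simp: dle_def meet_assoc meet_idem_left intro: meet_eq_trans)
  ultimately have "?P \<in> ?A"
    by auto
  then have "?A \<noteq> {}"
    by blast
  have chain: "\<Union>\<C> \<in> ?A" if "\<C> \<noteq> {}" "subset.chain ?A \<C>" for \<C>
  proof -
    have sub: "\<C> \<subseteq> ?A" and lin: "\<And>X Y. \<lbrakk>X \<in> \<C>; Y \<in> \<C>\<rbrakk> \<Longrightarrow> X \<subseteq> Y \<or> Y \<subseteq> X"
      using that by (auto simp: subset_chain_def)
    have "a \<sqinter> b \<in> \<Union>\<C>" if ab: "a \<in> \<Union>\<C>" "b \<in> \<Union>\<C>" for a b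
    proof -
      from ab obtain X Y where "X \<in> \<C>" "Y \<in> \<C>" "a \<in> X" "b \<in> Y"
        by blast
      then obtain Z where "Z \<in> \<C>" "a \<in> Z" "b \<in> Z"
        using lin by blast
      then show ?thesis
        using sub unfolding dba_filter_def by blast
    qed
    moreover have "b \<in> \<Union>\<C>" if "a \<in> \<Union>\<C>" "a \<sqsubseteq> b" for a b
      using that sub unfolding dba_filter_def by blast
    ultimately show ?thesis
      using sub \<open>\<C> \<noteq> {}\<close> by (auto simp: dba_filter_def)
  qed
  obtain F where F: "F \<in> ?A" and max: "\<forall>G\<in>?A. F \<subseteq> G \<longrightarrow> G = F"
    using subset_Zorn_nonempty[OF \<open>?A \<noteq> {}\<close> chain] by (rule bexE)
  have "F \<in> primary_filters D"
  proof (rule maximal_disjoint_filter_primary[OF N_vee N_down \<open>N \<noteq> {}\<close>])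
    show "dba_filter D F" "F \<noteq> {}" "F \<inter> N = {}"
      using F by auto
    \<comment> \<open>Being above F, such a G contains x and so competes in
      \<open>?A\<close>.\<close>
    show "G = F" if "dba_filter D G" "F \<subseteq> G" "G \<inter> N = {}" for G
      using max F that by (auto dest: bspec[where x = G])
  qed
  then show ?thesis
    using F by blast
qed

text \<open>The elements whose square is below that of y form a set N containing y. If x \<sqinter>
  x is not in N, some primary filter contains x and avoids N, hence omits y.\<close>

lemma filters_at_subset_imp_meet:
  assumes "filters_at D x \<subseteq> filters_at D y"
  shows "x \<sqinter> y = x \<sqinter> x"
proof (rule ccontr)
  assume neq: "x \<sqinter> y \<noteq> x \<sqinter> x"
  let ?N = "{z. z \<sqinter> y = z \<sqinter> z}"
  have "u \<curlyvee> v \<in> ?N" if "u \<in> ?N" "v \<in> ?N" for u v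
    using that meet_vee_distrib[of y u v] by (simp add: meet_commute vee_meet_idem vee_idem)
  moreover have "v \<in> ?N" if "u \<in> ?N" "v \<sqsubseteq> u" for u v
    using that meet_eq_trans unfolding dle_def mem_Collect_eq by blast
  moreover have "x \<sqinter> x \<notin> ?N"
    using neq by (simp add: meet_idem_left meet_right_idem)
  ultimately obtain F where "F \<in> primary_filters D" "x \<in> F" "F \<inter> ?N = {}"
    using primary_filter_exists[of ?N x] by blast
  then show False
    using assms by (auto simp: filters_at_def)
qed

lemma filters_at_eq_iff: "filters_at D x = filters_at D y \<longleftrightarrow> x \<sqinter> x = y \<sqinter> y"
proof
  assume "filters_at D x = filters_at D y"
  then show "x \<sqinter> x = y \<sqinter> y"
    using filters_at_subset_imp_meet[of x y] filters_at_subset_imp_meet[of y x] meet_commute by simp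
next
  assume "x \<sqinter> x = y \<sqinter> y"
  then show "filters_at D x = filters_at D y"
    using filters_at_meet[of x x] filters_at_meet[of y y] by simp
qed

section \<open>Clopen sets of primary filters\<close>

text \<open>The sets \<open>filters_at D y\<close> form a base: meets handle finite intersections,
  and negation turns the complement of a subbasic closed set into another such set.\<close>

lemma openin_filter_topologyD:
  assumes "openin (filter_topology D) U" "F \<in> U"
  obtains y where "y \<in> F" "filters_at D y \<subseteq> U"
proof -
  have "generate_topology_on
      (insert (primary_filters D) ((\<lambda>C. primary_filters D - C) ` range (filters_at D))) U"
    using assms(1) unfolding filter_topology_def topology_of_closed_subbase_def
    by (simp add: openin_topology_generated_by_iff)
  then have "U \<subseteq> primary_filters D \<and> (\<forall>F\<in>U. \<exists>y\<in>F. filters_at D y \<subseteq> U)"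
  proof induction
    case Empty
    then show ?case by simp
  next
    case (Int S T)
    show ?case
    proof (intro conjI ballI)
      fix F assume "F \<in> S \<inter> T"
      then have "F \<in> primary_filters D" "F \<in> S" "F \<in> T"
        using Int.IH by auto
      moreover obtain y where "y \<in> F" "filters_at D y \<subseteq> S"
        using Int.IH(1) \<open>F \<in> S\<close> by auto
      moreover obtain z where "z \<in> F" "filters_at D z \<subseteq> T"
        using Int.IH(2) \<open>F \<in> T\<close> by auto
      ultimately show "\<exists>y\<in>F. filters_at D y \<subseteq> S \<inter> T"
        by (intro bexI[of _ "y \<sqinter> z"]) (auto simp: filters_at_meet mem_primary_filter_meet_iff)
    qed (use Int.IH in blast)
  next
    case (UN K)
    show ?case
    proof (intro conjI ballI)
      show "\<Union>K \<subseteq> primary_filters D"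
        using UN.IH by auto
      fix F assume "F \<in> \<Union>K"
      then obtain S where "S \<in> K" "F \<in> S"
        by auto
      then obtain y where "y \<in> F" "filters_at D y \<subseteq> S"
        using UN.IH by meson
      then show "\<exists>y\<in>F. filters_at D y \<subseteq> \<Union>K"
        using \<open>S \<in> K\<close> by auto
    qed
  next
    case (Basis S)
    then consider "S = primary_filters D" | x where "S = filters_at D (\<^bold>\<not> x)"
      by (auto simp: filters_at_neg)
    then show ?case
    proof cases
      case 1
      \<comment> \<open>For the whole space any element of F serves as y; F is nonempty because it
        is primary.\<close>
      then show ?thesis
        by (auto simp: primary_filters_def filters_at_def)
    next
      case 2
      then show ?thesis
        by (auto simp: filters_at_def)
    qed
  qed
  then show thesis
    using assms(2) that by blast
qed

text \<open>A compactness argument: one basic set inside A and one inside its complement together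
  cover the space, so the first is A. Conversely, negation swaps \<open>filters_at D x\<close> with
  its complement, so both are open.\<close>

lemma clopen_in_filter_topology_iff:
  "clopen_in (filter_topology D) A \<longleftrightarrow> (\<exists>x. A = filters_at D x)"
proof
  assume "clopen_in (filter_topology D) A"
  then have op: "openin (filter_topology D) A" "openin (filter_topology D) (primary_filters D - A)"
    and sub: "A \<subseteq> primary_filters D"
    using openin_subset[of "filter_topology D" A] by (auto simp: clopen_in_def closedin_def)
  \<comment> \<open>The elements covered by a finite piece of \<open>A\<close> and one of its complement; if the top element
    is not among them, a primary filter avoiding all of them lies on neither side.\<close>
  define N where "N = {y. \<exists>a b. filters_at D a \<subseteq> A \<and> filters_at D b \<subseteq> primary_filters D - A \<and>
    filters_at D y \<subseteq> filters_at D a \<union> filters_at D b}"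
  have "filters_at D \<bottom> = filters_at D (\<bottom> \<sqinter> \<^bold>\<not> \<bottom>)"
    by (simp add: meet_neg)
  also have "\<dots> = {}"
    by (auto simp only: filters_at_meet filters_at_neg)
  finally have "filters_at D \<bottom> = {}" .
  then have "\<bottom> \<in> N"
    by (auto simp: N_def)
  have vee: "y \<curlyvee> z \<in> N" if yz: "y \<in> N" "z \<in> N" for y z
  proof -
    from yz obtain a b a' b' where
      "filters_at D a \<subseteq> A" "filters_at D b \<subseteq> primary_filters D - A"
      "filters_at D y \<subseteq> filters_at D a \<union> filters_at D b"
      "filters_at D a' \<subseteq> A" "filters_at D b' \<subseteq> primary_filters D - A"
      "filters_at D z \<subseteq> filters_at D a' \<union> filters_at D b'"
      unfolding N_def mem_Collect_eq by metis
    \<comment> \<open>Finite unions of basic sets on the same side of A are again basic, by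
      \<curlyvee>.\<close>
    then show ?thesis
      unfolding N_def mem_Collect_eq
      by (intro exI[of _ "a \<curlyvee> a'"] exI[of _ "b \<curlyvee> b'"]) (unfold filters_at_vee, blast)
  qed
  have down: "z \<in> N" if "y \<in> N" "z \<sqsubseteq> y" for y z
    using that filters_at_mono[of z y] unfolding N_def by blast
  have small: "y \<in> N" if "filters_at D y \<subseteq> A \<or> filters_at D y \<subseteq> primary_filters D - A" for y
    using that \<open>filters_at D \<bottom> = {}\<close> unfolding N_def mem_Collect_eq
    by (metis Un_upper1 Un_upper2 empty_subsetI)
  have "\<top> \<sqinter> \<top> \<in> N"
  proof (rule ccontr)
    assume top: "\<top> \<sqinter> \<top> \<notin> N"
    have "N \<noteq> {}"
      using \<open>\<bottom> \<in> N\<close> by auto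
    have "\<exists>F\<in>primary_filters D. \<top> \<in> F \<and> F \<inter> N = {}"
      by (rule primary_filter_exists; fact vee down \<open>N \<noteq> {}\<close> top)
    then obtain F where F: "F \<in> primary_filters D" "F \<inter> N = {}"
      by blast
    \<comment> \<open>Whichever side F lies on is open, so it contains a basic neighbourhood of F.
      The element y defining that neighbourhood lies both in F and in N.\<close>
    show False
    proof (cases "F \<in> A")
      case True
      then obtain y where "y \<in> F" "filters_at D y \<subseteq> A"
        using openin_filter_topologyD[OF op(1)] by blast
      then show False
        using F small by auto
    next
      case False
      then obtain y where "y \<in> F" "filters_at D y \<subseteq> primary_filters D - A"
        using openin_filter_topologyD[OF op(2), of F] F(1) by blast
      then show False
        using F small by auto
    qed
  qed
  moreover have "filters_at D (\<top> \<sqinter> \<top>) = primary_filters D"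
    using filters_at_neg[of \<bottom>] \<open>filters_at D \<bottom> = {}\<close> by (simp add: neg_bot)
  ultimately obtain a b where "filters_at D a \<subseteq> A" "filters_at D b \<subseteq> primary_filters D - A"
    "primary_filters D \<subseteq> filters_at D a \<union> filters_at D b"
    unfolding N_def by auto
  then have "A = filters_at D a"
    using sub by blast
  then show "\<exists>x. A = filters_at D x" ..
next
  have op: "openin (filter_topology D) (primary_filters D - filters_at D x)" for x
    unfolding filter_topology_def topology_of_closed_subbase_def
    by (rule topology_generated_by_Basis) auto
  have sub: "filters_at D x \<subseteq> primary_filters D" for x
    by (auto simp: filters_at_def)
  assume "\<exists>x. A = filters_at D x"
  then obtain x where A: "A = filters_at D x" ..
  moreover have "openin (filter_topology D) (filters_at D x)"
    using op[of "\<^bold>\<not> x"] sub[of x] by (simp add: filters_at_neg double_diff)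
  ultimately show "clopen_in (filter_topology D) A"
    using op[of x] sub[of x] by (simp add: clopen_in_def closedin_def)
qed

section \<open>Derivation operators\<close>

text \<open>If x \<sqinter> x is not in I, the prime ideal theorem with I as N gives a primary
  filter through x disjoint from I. If it is in I, it lies in I and in every filter containing
  x.\<close>

lemma common_attributes_filters_at:
  "common_attributes (primary_ideals D) (\<lambda>F I. F \<inter> I \<noteq> {}) (filters_at D x) =
    ideals_at D (x \<sqinter> x)"
proof (intro equalityI subsetI)
  fix I
  assume "I \<in> common_attributes (primary_ideals D) (\<lambda>F I. F \<inter> I \<noteq> {}) (filters_at D x)"
  then have I: "I \<in> primary_ideals D"
    and meets: "\<And>F. \<lbrakk>F \<in> primary_filters D; x \<in> F\<rbrakk> \<Longrightarrow> F \<inter> I \<noteq> {}"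
    by (auto simp: common_attributes_def filters_at_def)
  have join: "\<And>y z. \<lbrakk>y \<in> I; z \<in> I\<rbrakk> \<Longrightarrow> y \<squnion> z \<in> I" and down: "\<And>y z. \<lbrakk>y \<in> I; z \<sqsubseteq> y\<rbrakk> \<Longrightarrow> z \<in> I"
    and "I \<noteq> {}"
    using I by (auto simp: primary_ideals_def dba_ideal_def)
  have vee: "y \<curlyvee> z \<in> I" if "y \<in> I" "z \<in> I" for y z
  proof (rule down[OF join[OF that]])
    \<comment> \<open>Distributing and absorbing leaves (y \<sqinter> y) \<curlyvee> (z \<sqinter>
      z), and \<curlyvee> does not see squares.\<close>
    have "(y \<squnion> z) \<sqinter> (y \<curlyvee> z) = y \<curlyvee> z"
      by (metis meet_vee_distrib meet_commute meet_join_absorb join_commute vee_meet_idem)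
    then show "y \<curlyvee> z \<sqsubseteq> y \<squnion> z"
      by (metis meet_dle_left)
  qed
  have "\<exists>F\<in>primary_filters D. x \<in> F \<and> F \<inter> I = {}" if "x \<sqinter> x \<notin> I"
    by (rule primary_filter_exists; fact vee down \<open>I \<noteq> {}\<close> that)
  then have "x \<sqinter> x \<in> I"
    using meets by blast
  then show "I \<in> ideals_at D (x \<sqinter> x)"
    using I by (simp add: ideals_at_def)
next
  fix I
  assume "I \<in> ideals_at D (x \<sqinter> x)"
  then show "I \<in> common_attributes (primary_ideals D) (\<lambda>F I. F \<inter> I \<noteq> {}) (filters_at D x)"
    using primary_filterD(1)
    by (fastforce simp: common_attributes_def filters_at_def ideals_at_def)
qed

text \<open>The dual of the preceding lemma; the relation is symmetric, so exchanging objects and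
  attributes preserves it.\<close>

lemma common_objects_ideals_at:
  "common_objects (primary_filters D) (\<lambda>F I. F \<inter> I \<noteq> {}) (ideals_at D x) =
    filters_at D (x \<squnion> x)"
  using double_Boolean_algebra.common_attributes_filters_at[OF double_Boolean_algebra_dual, of x]
  by (simp add: primary_filters_dual primary_ideals_dual filters_at_dual ideals_at_dual
      common_attributes_def common_objects_def Int_commute)

lemma clopen_in_ideal_topology_iff:
  "clopen_in (ideal_topology D) B \<longleftrightarrow> (\<exists>x. B = ideals_at D x)"
  using double_Boolean_algebra.clopen_in_filter_topology_iff[OF double_Boolean_algebra_dual]
  by (simp add: filter_topology_dual filters_at_dual)

section \<open>Clopen protoconcepts and semiconcepts\<close>

lemma filters_at_meet_idem: "filters_at D (x \<sqinter> x) = filters_at D x"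
  by (simp add: filters_at_meet)

lemma ideals_at_join_idem: "ideals_at D (x \<squnion> x) = ideals_at D x"
  using double_Boolean_algebra.filters_at_meet_idem[OF double_Boolean_algebra_dual, of x]
  by (simp add: filters_at_dual)

text \<open>With u = y \<sqinter> y, the double derivative of A is
  \<open>filters_at D (u \<squnion> u)\<close> and the derivative of B is
  \<open>filters_at D (x \<squnion> x)\<close>. These agree iff the meet squares do.\<close>

lemma protoconcept_filters_at_ideals_at_iff:
  "protoconcept (primary_filters D) (primary_ideals D) (\<lambda>F I. F \<inter> I \<noteq> {})
      (filters_at D y, ideals_at D x) \<longleftrightarrow>
    (y \<sqinter> y) \<squnion> (y \<sqinter> y) = (x \<squnion> x) \<sqinter> (x \<squnion> x)"
proof -
  have "filters_at D y \<subseteq> primary_filters D" "ideals_at D x \<subseteq> primary_ideals D"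
    by (auto simp: filters_at_def ideals_at_def)
  \<comment> \<open>The left side is already its own meet square, by
    \<open>meet_join_idem\<close>.\<close>
  moreover have "((y \<sqinter> y) \<squnion> (y \<sqinter> y)) \<sqinter> ((y \<sqinter> y) \<squnion> (y \<sqinter> y)) = (y \<sqinter> y) \<squnion> (y \<sqinter> y)"
    by (simp add: meet_join_idem meet_ac meet_left_idem)
  ultimately show ?thesis
    by (simp add: protoconcept_def common_attributes_filters_at common_objects_ideals_at
        filters_at_eq_iff)
qed

lemma clopen_protoconcept_dba_context_iff:
  "clopen_protoconcept (dba_context D) (A, B) \<longleftrightarrow>
    (\<exists>y x. A = filters_at D y \<and> B = ideals_at D x \<and>
      (y \<sqinter> y) \<squnion> (y \<sqinter> y) = (x \<squnion> x) \<sqinter> (x \<squnion> x))"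
  unfolding clopen_protoconcept_def dba_context_def prod.case
    clopen_in_filter_topology_iff clopen_in_ideal_topology_iff
    topspace_filter_topology topspace_ideal_topology
  using protoconcept_filters_at_ideals_at_iff by metis

lemma fully_contextual_clopen_protoconcept_iff:
  assumes "fully_contextual D"
  shows "clopen_protoconcept (dba_context D) (A, B) \<longleftrightarrow>
    (\<exists>x. A = filters_at D x \<and> B = ideals_at D x)"
proof
  assume "clopen_protoconcept (dba_context D) (A, B)"
  then obtain y x where A: "A = filters_at D y" and B: "B = ideals_at D x"
    and eq: "(y \<sqinter> y) \<squnion> (y \<sqinter> y) = (x \<squnion> x) \<sqinter> (x \<squnion> x)"
    by (auto simp: clopen_protoconcept_dba_context_iff)
  have "y \<sqinter> y \<in> meet_idempotents D" "x \<squnion> x \<in> join_idempotents D"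
    by (simp_all add: meet_idempotents_def join_idempotents_def)
      (metis meet_idem_left meet_right_idem, metis join_commute join_idem_left)
  \<comment> \<open>This z represents the pair, since \<open>filters_at\<close> and
    \<open>ideals_at\<close> depend only on the meet square and the join square
    respectively.\<close>
  then obtain z where "z \<sqinter> z = y \<sqinter> y" "z \<squnion> z = x \<squnion> x"
    using assms eq unfolding fully_contextual_def by blast
  then show "\<exists>x. A = filters_at D x \<and> B = ideals_at D x"
    using A B filters_at_meet_idem ideals_at_join_idem by metis
next
  assume "\<exists>x. A = filters_at D x \<and> B = ideals_at D x"
  then show "clopen_protoconcept (dba_context D) (A, B)"
    using clopen_protoconcept_dba_context_iff meet_join_idem by blast
qed

lemma pure_clopen_semiconcept_iff:
  assumes "pure_dba D"
  shows "clopen_semiconcept (dba_context D) (A, B) \<longleftrightarrow>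
    (\<exists>x. A = filters_at D x \<and> B = ideals_at D x)"
proof
  assume "clopen_semiconcept (dba_context D) (A, B)"
  then obtain y x where AB: "A = filters_at D y" "B = ideals_at D x"
    and "ideals_at D (y \<sqinter> y) = B \<or> filters_at D (x \<squnion> x) = A"
    by (auto simp: clopen_semiconcept_def dba_context_def semiconcept_def
        clopen_in_filter_topology_iff clopen_in_ideal_topology_iff
        common_attributes_filters_at common_objects_ideals_at)
  \<comment> \<open>The witness is y \<sqinter> y in the first case and x \<squnion> x in the
    second: squaring leaves one component unchanged and turns the other into the given
    derivative.\<close>
  then show "\<exists>x. A = filters_at D x \<and> B = ideals_at D x"
    using filters_at_meet_idem ideals_at_join_idem by metis
next
  assume "\<exists>x. A = filters_at D x \<and> B = ideals_at D x"
  then obtain x where AB: "A = filters_at D x" "B = ideals_at D x"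
    by blast
  moreover have "A \<subseteq> primary_filters D" "B \<subseteq> primary_ideals D"
    by (auto simp: AB filters_at_def ideals_at_def)
  \<comment> \<open>Purity decides which derivation closes the pair: a meet idempotent x makes B the
    derivative of A, a join idempotent x makes A the derivative of B.\<close>
  moreover have "x \<sqinter> x = x \<or> x \<squnion> x = x"
    using assms by (simp add: pure_dba_def)
  ultimately show "clopen_semiconcept (dba_context D) (A, B)"
    by (auto simp: clopen_semiconcept_def dba_context_def semiconcept_def
        clopen_in_filter_topology_iff clopen_in_ideal_topology_iff
        common_attributes_filters_at common_objects_ideals_at)
qed

end

theorem theorem4p17:
  fixes D :: "'a dba_ops" and A B :: "'a set set"
  assumes "double_Boolean_algebra D"
    and "A \<subseteq> primary_filters D" and "B \<subseteq> primary_ideals D"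
  shows "(fully_contextual D \<longrightarrow>
      (clopen_protoconcept (dba_context D) (A, B) \<longleftrightarrow>
        (\<exists>x. A = filters_at D x \<and> B = ideals_at D x))) \<and>
    (pure_dba D \<longrightarrow>
      (clopen_semiconcept (dba_context D) (A, B) \<longleftrightarrow>
        (\<exists>x. A = filters_at D x \<and> B = ideals_at D x)))"
  using double_Boolean_algebra.fully_contextual_clopen_protoconcept_iff[OF assms(1)]
    double_Boolean_algebra.pure_clopen_semiconcept_iff[OF assms(1)]
  by blast

end
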